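(* Let $K$ be a field, $n\ge 1$, and $f(X,Y)=a_0(X)+a_1(X)Y+\cdots+a_n(X)Y^n\in K[X,Y]$, with $a_0,a_1,\dots,a_n\in K[X]$, $a_0a_n\neq 0$ and $$\deg a_n\ge\max\{\deg a_0,\deg a_1,\dots,\deg a_{n-1}\}.$$ If for a non-constant polynomial $g(X)\in K[X]$, the polynomial $f(X,g(X))$ is a power (with exponent $\ge 1$) of an irreducible polynomial over $K$, and $f(X,g(X))$ and $\frac{\partial f}{\partial Y}(X,g(X))$ are relatively prime, then $f(X,Y)$, viewed as a polynomial in $Y$, is irreducible over $K(X)$.
   Context: All degrees are in $X$, and the zero polynomial has degree $-\infty$. *)

theory Defs
  imports "HOL-Computational_Algebra.Computational_Algebra"
begin

text \<open>
  Encoding: \<open>K[X,Y]\<close> is \<open>'a poly poly\<close>, where the inner indeterminate is \<open>X\<close> and the outer one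
  is \<open>Y\<close>. Thus, for \<open>f :: 'a poly poly\<close> and \<open>g :: 'a poly\<close>, the term \<open>poly f g\<close> is
  \<open>f(X, g(X))\<close> and \<open>pderiv f\<close> is the partial derivative with respect to \<open>Y\<close>. The field
  \<open>K(X)\<close> is \<open>'a poly fract\<close>, and \<open>fract_poly f\<close> is \<open>f\<close> viewed as a polynomial in \<open>Y\<close> over it.

  Degrees: here \<open>degree 0 = 0\<close>, rather than minus infinity. The maximum of the degrees of
  \<open>a 0, ..., a (n - 1)\<close> is unaffected, because \<open>a 0\<close> is assumed to be nonzero.
\<close>

end

theory Submission
  imports Defs
begin

text \<open>
  Suppose \<open>f\<close> is reducible over \<open>K(X)\<close>. By Gauss's lemma \<open>f = u v\<close> with \<open>u, v\<close> in \<open>K[X][Y]\<close> of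
  positive degree in \<open>Y\<close>. A common divisor of \<open>u(X, g)\<close> and \<open>v(X, g)\<close> divides both \<open>f(X, g)\<close>
  and, by the product rule, its partial derivative at \<open>(X, g)\<close>; so, \<open>f(X, g)\<close> being a prime
  power, one of the two, say \<open>u(X, g)\<close>, is constant. The Gauss norm, the maximal \<open>X\<close>-degree of
  the coefficients, is multiplicative, and hence a factor \<open>u\<close> of \<open>f\<close> inherits that its leading
  coefficient has maximal degree. But then no cancellation can occur in the top degree of
  \<open>u(X, g)\<close>, which is therefore not constant.
\<close>

text \<open>\<open>M\<close> and \<open>N\<close> are only upper bounds, so that one pair can serve
  for all coefficients of two polynomials in \<open>Y\<close> at once. In the convolution sum only
  the index \<open>M\<close> survives.\<close>

lemma coeff_mult_degree_bounds:
  fixes p q :: "'a::comm_semiring_0 poly"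
  assumes "degree p \<le> M" "degree q \<le> N"
  shows "coeff (p * q) (M + N) = coeff p M * coeff q N"
proof -
  have "coeff p i * coeff q (M + N - i) = 0" if "i \<noteq> M" "i \<le> M + N" for i
  proof (cases "i < M")
    case True
    then have "degree q < M + N - i" using assms by linarith
    then show ?thesis by (simp add: coeff_eq_0)
  next
    case False
    then have "degree p < i" using assms that by linarith
    then show ?thesis by (simp add: coeff_eq_0)
  qed
  then have "(\<Sum>i\<le>M + N. coeff p i * coeff q (M + N - i)) =
      (\<Sum>i\<le>M + N. if i = M then coeff p M * coeff q N else 0)"
    by (intro sum.cong) auto
  then show ?thesis by (simp add: coeff_mult)
qed

text \<open>Extracting the coefficient of \<open>X^M\<close> from every coefficient gives the top
  part of \<open>u\<close> in \<open>X\<close>. Top parts multiply, which over a domain makes the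
  Gauss norm multiplicative.\<close>

lemma coeff_coeff_mult_degree_bounds:
  fixes u v :: "'a::comm_semiring_0 poly poly"
  assumes "\<And>i. degree (coeff u i) \<le> M" "\<And>i. degree (coeff v i) \<le> N"
  shows "map_poly (\<lambda>c. coeff c (M + N)) (u * v) =
    map_poly (\<lambda>c. coeff c M) u * map_poly (\<lambda>c. coeff c N) v"
  by (rule poly_eqI)
    (simp add: coeff_map_poly coeff_mult[of u] coeff_mult[of "map_poly _ u"] coeff_sum
      coeff_mult_degree_bounds assms)

lemma max_degree_coeff:
  fixes u :: "'a::zero poly poly"
  assumes "u \<noteq> 0"
  obtains M where "\<And>i. degree (coeff u i) \<le> M" "map_poly (\<lambda>c. coeff c M) u \<noteq> 0"
proof -
  define M where "M = Max ((\<lambda>i. degree (coeff u i)) ` {..degree u})"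
  have le: "degree (coeff u i) \<le> M" for i
  proof (cases "i \<le> degree u")
    case True
    then show ?thesis unfolding M_def by (intro Max_ge) auto
  qed (simp add: coeff_eq_0)
  have "M \<in> (\<lambda>i. degree (coeff u i)) ` {..degree u}"
    unfolding M_def by (intro Max_in) auto
  then obtain j where j: "M = degree (coeff u j)" by blast
  have "\<exists>i. coeff (coeff u i) M \<noteq> 0"
  \<comment> \<open>As \<open>degree 0 = 0\<close>, the maximum may be attained at a zero
    coefficient. Then \<open>M = 0\<close>, and the leading coefficient is a nonzero witness
    instead.\<close>
  proof (cases "coeff u j = 0")
    case True
    then have "degree (lead_coeff u) = M" using j le[of "degree u"] by simp
    then show ?thesis using assms by (metis leading_coeff_0_iff)
  next
    case False
    then show ?thesis using j by (metis leading_coeff_0_iff)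
  qed
  then have "map_poly (\<lambda>c. coeff c M) u \<noteq> 0"
    by (auto simp: poly_eq_iff coeff_map_poly)
  with le show thesis by (rule that)
qed

text \<open>Let \<open>M\<close> and \<open>N\<close> be the Gauss norms of \<open>u\<close> and
  \<open>v\<close>. Some coefficient of \<open>u * v\<close> has degree at least
  \<open>M + N\<close>, hence so does its leading coefficient, the product of those of
  \<open>u\<close> and \<open>v\<close>. The one of \<open>v\<close> contributes at most
  \<open>N\<close>, so the one of \<open>u\<close> has degree at least \<open>M\<close>.\<close>

lemma lead_coeff_dominant_factor:
  fixes u v :: "'a::idom poly poly"
  assumes "u * v \<noteq> 0"
    and dom: "\<And>i. degree (coeff (u * v) i) \<le> degree (lead_coeff (u * v))"
  shows "degree (coeff u i) \<le> degree (lead_coeff u)"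
proof -
  have nz: "u \<noteq> 0" "v \<noteq> 0" using assms(1) by auto
  obtain M where M: "\<And>i. degree (coeff u i) \<le> M" "map_poly (\<lambda>c. coeff c M) u \<noteq> 0"
    using max_degree_coeff[OF nz(1)] by blast
  obtain N where N: "\<And>i. degree (coeff v i) \<le> N" "map_poly (\<lambda>c. coeff c N) v \<noteq> 0"
    using max_degree_coeff[OF nz(2)] by blast
  have "map_poly (\<lambda>c. coeff c (M + N)) (u * v) \<noteq> 0"
    using M N by (simp add: coeff_coeff_mult_degree_bounds)
  then obtain j where "coeff (coeff (u * v) j) (M + N) \<noteq> 0"
    by (auto simp: poly_eq_iff coeff_map_poly)
  then have "M + N \<le> degree (coeff (u * v) j)" by (rule le_degree)
  also have "\<dots> \<le> degree (lead_coeff (u * v))" by (rule dom)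
  also have "\<dots> = degree (lead_coeff u) + degree (lead_coeff v)"
    unfolding lead_coeff_mult using nz by (intro degree_mult_eq) auto
  also have "\<dots> \<le> degree (lead_coeff u) + N" using N(1) by simp
  finally show ?thesis using M(1)[of i] by linarith
qed

text \<open>Since \<open>g\<close> is non-constant, lowering the power of \<open>g\<close> strictly
  lowers the degree, and no coefficient can make up for the loss; the top term dominates the
  sum.\<close>

lemma degree_poly_dominant:
  fixes u :: "'a::idom poly poly"
  assumes dom: "\<And>i. degree (coeff u i) \<le> degree (lead_coeff u)"
    and "degree u > 0" "degree g > 0"
  shows "degree (poly u g) = degree (lead_coeff u) + degree u * degree g"
proof -
  let ?m = "degree u" and ?top = "lead_coeff u * g ^ degree u"
  have "lead_coeff u \<noteq> 0" "g \<noteq> 0" using assms by auto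
  then have top: "degree ?top = degree (lead_coeff u) + ?m * degree g"
    by (simp add: degree_mult_eq degree_power_eq)
  have "degree (coeff u i * g ^ i) < degree ?top" if "i < ?m" for i
  proof -
    have "degree (coeff u i * g ^ i) \<le> degree (coeff u i) + degree g * i"
      using degree_mult_le[of "coeff u i" "g ^ i"] degree_power_le[of g i] by linarith
    also have "\<dots> < degree (lead_coeff u) + degree g * ?m"
      using dom[of i] that assms(3) by (intro add_le_less_mono) auto
    finally show ?thesis by (simp only: top mult.commute)
  qed
  then have "degree (\<Sum>i<?m. coeff u i * g ^ i) < degree ?top"
    using assms top by (intro degree_sum_less) auto
  moreover have "poly u g = (\<Sum>i<?m. coeff u i * g ^ i) + ?top"
    by (simp add: poly_altdef lessThan_Suc_atMost[symmetric])
  ultimately show ?thesis using top by (simp add: degree_add_eq_right)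
qed

lemma clear_denominators:
  fixes U :: "'a::idom fract poly"
  obtains d u where "d \<noteq> 0" "smult (to_fract d) U = fract_poly u"
proof -
  have "\<exists>d u. d \<noteq> 0 \<and> smult (to_fract d) U = fract_poly u"
  proof (induction U)
    case 0
    show ?case by (intro exI[of _ 1] exI[of _ 0]) simp
  next
    case (pCons c U)
    then obtain d u where du: "d \<noteq> 0" "smult (to_fract d) U = fract_poly u" by blast
    obtain x y where xy: "c = to_fract x / to_fract y" "y \<noteq> 0"
      by (cases c) (auto simp: Fract_conv_to_fract)
    have "smult (to_fract (y * d)) U = fract_poly (smult y u)"
      using du(2) by (simp flip: smult_smult)
    then have "smult (to_fract (y * d)) (pCons c U) = fract_poly (pCons (x * d) (smult y u))"
      using xy by (simp add: map_poly_pCons)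
    then show ?case using du(1) xy(2) by (metis no_zero_divisors)
  qed
  then show thesis using that by blast
qed

text \<open>The core of Gauss's lemma. An irreducible \<open>d\<close> is prime in
  \<open>K[X]\<close> and stays prime as a constant of \<open>K[X][Y]\<close>, so it can be
  cancelled from \<open>u\<close> or from \<open>v\<close>. Any other non-unit \<open>d\<close> is
  split and its two factors are removed in turn, by induction on the degree.\<close>

lemma cancel_const_factor:
  fixes d :: "'a::field poly" and f u v :: "'a poly poly"
  assumes "d \<noteq> 0" "smult d f = u * v"
  shows "\<exists>u' v'. f = u' * v' \<and> degree u' = degree u \<and> degree v' = degree v"
  using assms
proof (induction "degree d" arbitrary: d f u v rule: less_induct)
  case less
  consider "is_unit d" | "irreducible d" |
    b c where "d = b * c" "\<not> is_unit b" "\<not> is_unit c"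
    using less.prems(1) unfolding irreducible_def by blast
  then show ?case
  proof cases
    case 1
    then obtain e where e: "1 = d * e" by (elim dvdE)
    then have "f = smult e (smult d f)" by (simp add: mult.commute)
    then have "f = smult e u * v" by (simp add: less.prems(2))
    moreover have "e \<noteq> 0" using e by auto
    ultimately show ?thesis by (metis degree_smult_eq)
  next
    case 2
    then have "prime_elem [:d:]"
      by (intro lift_prime_elem_poly field_poly_irreducible_imp_prime)
    moreover have "[:d:] dvd u * v"
      by (simp add: const_poly_dvd_iff flip: less.prems(2))
    ultimately consider w where "u = smult d w" | w where "v = smult d w"
      by (auto simp: prime_elem_dvd_mult_iff elim!: dvdE)
    then show ?thesis
    proof cases
      case 1
      then have "f = w * v" using less.prems by (auto intro: smult_cancel)
      then show ?thesis using 1 less.prems(1) by auto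
    next
      case 2
      then have "f = u * w" using less.prems by (auto intro: smult_cancel)
      then show ?thesis using 2 less.prems(1) by auto
    qed
  next
    case 3
    have nz: "b \<noteq> 0" "c \<noteq> 0" using 3(1) less.prems(1) by auto
    then have "degree b > 0" "degree c > 0"
      using 3 by (auto simp: is_unit_iff_degree)
    then have lt: "degree b < degree d" "degree c < degree d"
      using 3(1) nz by (auto simp: degree_mult_eq)
    have "smult b (smult c f) = u * v" using 3(1) less.prems(2) by simp
    from less.hyps[OF lt(1) nz(1) this] obtain u' v' where
      "smult c f = u' * v'" "degree u' = degree u" "degree v' = degree v" by blast
    with less.hyps[OF lt(2) nz(2), of f u' v'] show ?thesis by metis
  qed
qed

lemma fract_poly_factorization:
  fixes f :: "'a::field poly poly"
  assumes "fract_poly f = U * V"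
  obtains u v where "f = u * v" "degree u = degree U" "degree v = degree V"
proof -
  obtain d u where du: "d \<noteq> 0" "smult (to_fract d) U = fract_poly u"
    by (rule clear_denominators)
  obtain e v where ev: "e \<noteq> 0" "smult (to_fract e) V = fract_poly v"
    by (rule clear_denominators)
  have "fract_poly (smult (d * e) f) = smult (to_fract d) U * smult (to_fract e) V"
    by (simp add: assms ac_simps)
  also have "\<dots> = fract_poly (u * v)" by (simp add: du ev)
  finally have "smult (d * e) f = u * v" by (simp only: fract_poly_eq_iff)
  moreover have "degree u = degree U"
    using arg_cong[OF du(2), of degree] du(1) by (simp add: degree_map_poly)
  moreover have "degree v = degree V"
    using arg_cong[OF ev(2), of degree] ev(1) by (simp add: degree_map_poly)
  ultimately show thesis
    using cancel_const_factor[of "d * e" f u v] du(1) ev(1) that by auto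
qed

text \<open>If \<open>p * p ^ k = w * x\<close>, then \<open>p\<close> must divide the cofactor
  \<open>x\<close>; cancelling it leaves \<open>w\<close> as a divisor of
  \<open>p ^ k\<close>.\<close>

lemma is_unit_if_dvd_prime_power:
  fixes p w :: "'a::algebraic_semidom"
  assumes "prime_elem p" "w dvd p ^ k" "\<not> p dvd w"
  shows "is_unit w"
  using assms(2)
proof (induction k)
  case (Suc k)
  then obtain x where x: "p * p ^ k = w * x" by (auto elim: dvdE)
  then have "p dvd w * x" by (metis dvd_triv_left)
  then have "p dvd x" using assms(1,3) prime_elem_dvd_multD by blast
  then obtain y where "x = p * y" by (elim dvdE)
  with x have "p * p ^ k = p * (w * y)" by (simp add: mult.left_commute)
  then have "p ^ k = w * y" using assms(1) by (auto simp: prime_elem_def)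
  then show ?case using Suc.IH by simp
qed simp

lemma is_unit_value_factor:
  fixes u v :: "'a::field poly poly"
  assumes p: "irreducible p" and pow: "poly (u * v) g = p ^ k"
    and cop: "coprime (poly (u * v) g) (poly (pderiv (u * v)) g)"
  shows "is_unit (poly u g) \<or> is_unit (poly v g)"
proof -
  have "\<not> (p dvd poly u g \<and> p dvd poly v g)"
  proof
    assume "p dvd poly u g \<and> p dvd poly v g"
    then have "p dvd poly (u * v) g" "p dvd poly (pderiv (u * v)) g"
      \<comment> \<open>Each summand of the product rule retains \<open>u\<close> or
        \<open>v\<close> as a factor, so \<open>p\<close> divides both summands at
        \<open>g\<close>.\<close>
      by (auto simp: pderiv_mult)
    with cop have "is_unit p" by (rule coprime_common_divisor)
    then show False using p by (simp add: irreducible_def)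
  qed
  moreover have "poly u g dvd p ^ k" "poly v g dvd p ^ k"
    using pow by (auto simp flip: pow)
  ultimately show ?thesis
    using is_unit_if_dvd_prime_power field_poly_irreducible_imp_prime[OF p] by blast
qed

theorem corollary4p2:
  fixes a :: "nat \<Rightarrow> 'a::field poly"
    and f :: "'a poly poly"
    and g :: "'a poly"
    and n :: nat
  assumes "n \<ge> 1"
    and "f = (\<Sum>i\<le>n. monom (a i) i)"
    and "a 0 * a n \<noteq> 0"
    and "degree (a n) \<ge> (MAX i\<in>{..<n}. degree (a i))"
    and "degree g > 0"
    and "\<exists>p k. irreducible p \<and> k \<ge> 1 \<and> poly f g = p ^ k"
    and "coprime (poly f g) (poly (pderiv f) g)"
  shows "irreducible (fract_poly f)"
proof -
  have coeff_f: "coeff f i = (if i \<le> n then a i else 0)" for i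
    by (simp add: assms(2) coeff_sum)
  have deg_f: "degree f = n"
    using assms(3) by (intro antisym degree_le le_degree) (auto simp: coeff_f)
  have f0: "f \<noteq> 0" using deg_f assms(1) by auto
  have "degree (a i) \<le> degree (a n)" if "i < n" for i
    using that by (intro order.trans[OF Max_ge assms(4)]) auto
  then have dom: "degree (coeff f i) \<le> degree (lead_coeff f)" for i
    by (auto simp: deg_f coeff_f le_less)
  have no_unit: "\<not> is_unit (poly u g)" if "f = u * v" "degree u > 0" for u v
  proof -
    have "degree (coeff u i) \<le> degree (lead_coeff u)" for i
      using that(1) f0 dom by (intro lead_coeff_dominant_factor[of u v]) auto
    then have "degree (poly u g) > 0"
      using that(2) assms(5) by (simp add: degree_poly_dominant)
    then show ?thesis by (auto simp: is_unit_poly_iff)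
  qed
  show ?thesis
  proof (rule irreducibleI)
    show "fract_poly f \<noteq> 0" using f0 by simp
    have "degree (fract_poly f) = n" by (simp add: degree_map_poly deg_f)
    then show "\<not> is_unit (fract_poly f)" using assms(1) by (auto simp: is_unit_poly_iff)
  next
    fix U V assume UV: "fract_poly f = U * V"
    then have "U \<noteq> 0" "V \<noteq> 0" using f0 by auto
    \<comment> \<open>Over the field \<open>K(X)\<close> being a unit depends only on the degree in
      \<open>Y\<close>, which the factorization over \<open>K[X]\<close> preserves.\<close>
    then have units: "is_unit U \<longleftrightarrow> degree U = 0" "is_unit V \<longleftrightarrow> degree V = 0"
      by (simp_all add: is_unit_iff_degree)
    obtain u v where uv: "f = u * v" "degree u = degree U" "degree v = degree V"
      using fract_poly_factorization[OF UV] .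
    have "is_unit (poly u g) \<or> is_unit (poly v g)"
      using assms(6,7) is_unit_value_factor unfolding uv(1) by blast
    then have "degree u = 0 \<or> degree v = 0"
      using no_unit[of u v] no_unit[of v u] uv(1) by (auto simp: mult.commute)
    then show "is_unit U \<or> is_unit V" using uv units by simp
  qed
qed

end
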